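(* Let $(\delta_n)_{n\in\mathbb N}$ be a sequence of numbers in $[0,1]$ such that $\lim_{n\to\infty}\delta_n=1$. If $(G_n)_{n\in\mathbb N}$ is a sequence of directed acyclic graphs with uniformly bounded in-degrees, then $(G_n)$ is not an $(n^{\delta_n})$-extender sequence.
   Context: A graph is a pair $G=(V,E)$ with $V$ a non-empty finite set and $E\subset V\times V$ disjoint from the diagonal; elements of $E$ are directed edges. The in-degree of $v$ is the number of $x$ with $(x,v)\in E$. A directed simple path of length $D\ge 0$ is a tuple $(x_0,\ldots,x_D)$ of pairwise distinct vertices with $(x_i,x_{i+1})\in E$ for all $i<D$. A directed acyclic graph (dag) is a graph with no directed cycles. For a proper subset $S\subsetneq V(G)$, $\operatorname{codepth}(S;G)\in\mathbb N$ is the maximal $D$ such that there exists a directed simple path $(x_0,\ldots,x_D)$ in $G$ disjoint from $S$. For $\varepsilon,\rho>0$, a dag $G$ is an $(\varepsilon,\rho)$-extender if for every $S\subsetneq V(G)$ with $|S|\le \varepsilon|V(G)|$ we have $\operatorname{codepth}(S;G)\ge\rho$. For a sequence $(\rho_n)$ of positive reals with $\rho_n\to\infty$, a sequence $(G_n)$ of dags with uniformly bounded in-degrees is a $(\rho_n)$-extender sequence if $|V(G_n)|\to\infty$ and there exist $\varepsilon>0$, $C>0$ such that for all $n$, $G_n$ is an $(\varepsilon, C\rho_{|V(G_n)|})$-extender. Here $\rho_n=n^{\delta_n}$ (only indices $n\ge1$ matter, as vertex sets are non-empty). *)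

theory Defs
  imports Complex_Main "Graph_Theory.Graph_Theory"
begin

locale dag = pair_digraph G for G :: "'a pair_pre_digraph" +
  assumes verts_nonempty: "pverts G \<noteq> {}"
    and no_cycle: "\<not> cycle p"

lemma (in dag) acyclic_parcs: "acyclic (parcs G)"
proof (rule acyclicI, intro allI notI)
  fix x assume "(x, x) \<in> (parcs G)\<^sup>+"
  then obtain p where "awalk x p x" "p \<noteq> []" using reachable1_awalk by auto
  then show False using no_cycle closed_w_imp_cycle[of p]
    unfolding closed_w_def by auto
qed

definition codepth :: "'a set \<Rightarrow> 'a pair_pre_digraph \<Rightarrow> nat" where
  "codepth S G = Max {vwalk_length p | p. vpath p (with_proj G) \<and> set p \<inter> S = {}}"

text \<open>The maximum in \<^const>\<open>codepth\<close> is taken over a finite non-empty set whenever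
  \<^term>\<open>S\<close> is a proper subset of the vertex set, the only case used below.\<close>

lemma (in pair_fin_digraph) finite_codepth_set:
  "finite {vwalk_length p | p. vpath p (with_proj G) \<and> set p \<inter> S = {}}"
proof -
  have "finite {p. vpath p (with_proj G)}" by (rule vpaths_finite)
  then have "finite (vwalk_length ` {p. vpath p (with_proj G)})" by (rule finite_imageI)
  then show ?thesis by (rule rev_finite_subset) blast
qed

lemma codepth_set_nonempty:
  assumes "S \<subset> pverts G"
  shows "{vwalk_length p | p. vpath p (with_proj G) \<and> set p \<inter> S = {}} \<noteq> {}"
proof -
  from assms obtain v where v: "v \<in> pverts G" "v \<notin> S" by blast
  then have "vpath [v] (with_proj G)" by (intro vpathI vwalkI) auto
  with v(2) show ?thesis by fastforce
qed

definition extender :: "real \<Rightarrow> real \<Rightarrow> 'a pair_pre_digraph \<Rightarrow> bool" where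
  "extender \<epsilon> \<rho> G \<longleftrightarrow> dag G \<and>
    (\<forall>S. S \<subset> pverts G \<and> real (card S) \<le> \<epsilon> * real (card (pverts G)) \<longrightarrow>
      real (codepth S G) \<ge> \<rho>)"

definition bounded_in_degrees :: "(nat \<Rightarrow> 'a pair_pre_digraph) \<Rightarrow> bool" where
  "bounded_in_degrees G \<longleftrightarrow>
    (\<exists>d. \<forall>n. \<forall>v \<in> pverts (G n). in_degree (with_proj (G n)) v \<le> d)"

text \<open>Intended for sequences \<^term>\<open>\<rho>\<close> that are positive at indices \<^term>\<open>n \<ge> 1\<close> and tend to
  infinity. The value at \<^term>\<open>0\<close> is never used, since vertex sets are non-empty.\<close>

definition extender_seq :: "(nat \<Rightarrow> real) \<Rightarrow> (nat \<Rightarrow> 'a pair_pre_digraph) \<Rightarrow> bool" where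
  "extender_seq \<rho> G \<longleftrightarrow>
    (\<forall>n. dag (G n)) \<and> bounded_in_degrees G \<and>
    filterlim (\<lambda>n. card (pverts (G n))) at_top sequentially \<and>
    (\<exists>\<epsilon>>0. \<exists>C>0. \<forall>n. extender \<epsilon> (C * \<rho> (card (pverts (G n)))) (G n))"

end

theory Submission
  imports Defs
begin

text \<open>
  This is Valiant's depth reduction. Label the \<open>N\<close> vertices with numbers below \<open>2\<^sup>k\<close>, where
  \<open>2\<^sup>k \<le> 2N\<close>, increasingly along arcs, and sort the arcs into \<open>k\<close> classes according to
  the topmost binary digit in which the labels of their endpoints differ. Once all arcs of the classes
  in \<open>I\<close> are cut, erasing the digits in \<open>I\<close> still leaves labels that increase along arcs, so
  every remaining path has at most \<open>2\<^bsup>k - |I|\<^esup>\<close> vertices. With in-degrees at most \<open>d\<close>, the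
  \<open>\<epsilon>k/d\<close> smallest classes together have at most \<open>\<epsilon>N\<close> arcs, so deleting their heads reduces the
  depth to \<open>O(N\<^bsup>1 - \<epsilon>/d\<^esup>)\<close>, which is eventually smaller than any constant multiple of
  \<open>N\<^bsup>\<delta>\<^esup>\<close> with \<open>\<delta>\<close> tending to 1.
\<close>

section \<open>Erasing binary digits\<close>

text \<open>Kept digits stay at their original places instead of being packed together. For finite
  \<open>J\<close> the number of values is therefore bounded in terms of \<open>card J\<close>,
  while their size is not.\<close>

definition mask_bits :: "nat set \<Rightarrow> nat \<Rightarrow> nat" where
  "mask_bits J x = (\<Sum>j\<in>J. of_bool (bit x j) * 2 ^ j)"

text \<open>The maximum is meaningful only for \<open>x \<noteq> y\<close>, when the set of
  differing positions is non-empty; it is finite because natural numbers have finitely many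
  digits.\<close>

definition top_diff :: "nat \<Rightarrow> nat \<Rightarrow> nat" where
  "top_diff x y = Max {j. bit x j \<noteq> bit y j}"

text \<open>Digits above \<open>i\<close> contribute equally to both sides, and those below
  \<open>i\<close> contribute at most \<open>2 ^ i - 1\<close> to \<open>x\<close>, less than the
  \<open>2 ^ i\<close> that digit \<open>i\<close> gives to \<open>y\<close> alone.\<close>

lemma mask_bits_less:
  assumes "finite J" "i \<in> J" "\<not> bit x i" "bit y i"
    and agree: "\<And>j. j > i \<Longrightarrow> bit x j = bit y j"
  shows "mask_bits J x < mask_bits J y"
proof -
  let ?L = "J \<inter> {..<i}" and ?H = "J \<inter> {i<..}"
  have split: "mask_bits J z = mask_bits ?L z + of_bool (bit z i) * 2 ^ i + mask_bits ?H z" for z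
  proof -
    have "J = insert i (?L \<union> ?H)" using assms(2) by auto
    then have "mask_bits J z = mask_bits (insert i (?L \<union> ?H)) z" by simp
    also have "\<dots> = of_bool (bit z i) * 2 ^ i + mask_bits (?L \<union> ?H) z"
      unfolding mask_bits_def using assms(1) by (subst sum.insert) auto
    also have "mask_bits (?L \<union> ?H) z = mask_bits ?L z + mask_bits ?H z"
      unfolding mask_bits_def using assms(1) by (intro sum.union_disjoint) auto
    finally show ?thesis by simp
  qed
  have "mask_bits ?L x \<le> (\<Sum>j<i. 2 ^ j)"
    unfolding mask_bits_def using assms(1)
    by (intro order_trans[OF sum_mono sum_mono2]) auto
  also have "\<dots> < 2 ^ i"
    by (simp add: lessThan_atLeast0 sum_power2)
  finally have "mask_bits ?L x < 2 ^ i" .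
  moreover have "mask_bits ?H x = mask_bits ?H y"
    unfolding mask_bits_def by (intro sum.cong) (auto simp: agree)
  ultimately show ?thesis
    using assms(3,4) unfolding split[of x] split[of y] by simp
qed

lemma mask_bits_lessThan:
  assumes "x < 2 ^ k"
  shows "mask_bits {..<k} x = x"
proof -
  have "mask_bits {..<k} x = (\<Sum>j = 0..<k. push_bit j (of_bool (bit x j)))"
    unfolding mask_bits_def by (simp add: lessThan_atLeast0 push_bit_eq_mult)
  also have "\<dots> = x" using assms by (simp add: take_bit_sum[symmetric] take_bit_nat_eq_self)
  finally show ?thesis .
qed

lemma top_diff:
  assumes "x < y" "y < 2 ^ k"
  shows "top_diff x y < k" "\<not> bit x (top_diff x y)" "bit y (top_diff x y)"
    and "\<And>j. j > top_diff x y \<Longrightarrow> bit x j = bit y j"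
proof -
  let ?D = "{j. bit x j \<noteq> bit y j}" and ?i = "top_diff x y"
  have high: "\<not> bit z j" if "z < 2 ^ k" "j \<ge> k" for z j :: nat
    using that by (metis bit_take_bit_iff leD take_bit_nat_eq_self)
  have x: "x < 2 ^ k" using assms by simp
  have sub: "?D \<subseteq> {..<k}"
    using high[OF x] high[OF assms(2)] by (auto intro: leI)
  then have fin: "finite ?D" using finite_subset by blast
  have "?D \<noteq> {}" using assms(1) bit_eqI[of x y] by auto
  with fin have i: "?i \<in> ?D" unfolding top_diff_def by (rule Max_in)
  with sub show lt: "?i < k" by auto
  show agree: "bit x j = bit y j" if "j > ?i" for j
  proof (rule ccontr)
    assume "bit x j \<noteq> bit y j"
    then have "j \<le> ?i" unfolding top_diff_def using fin by (intro Max_ge) auto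
    with that show False by simp
  qed
  \<comment> \<open>With all \<open>k\<close> digits kept, masking changes nothing, so a digit set
    in \<open>x\<close> but not in \<open>y\<close> at this place would force
    \<open>y < x\<close>.\<close>
  have "\<not> (bit x ?i \<and> \<not> bit y ?i)"
  proof
    assume "bit x ?i \<and> \<not> bit y ?i"
    then have "mask_bits {..<k} y < mask_bits {..<k} x"
      using lt agree by (intro mask_bits_less[of _ ?i]) auto
    then show False using assms x by (simp add: mask_bits_lessThan)
  qed
  with i show "\<not> bit x ?i" "bit y ?i" by auto
qed

text \<open>The topmost differing digit alone decides the order, so the order survives the erasure
  of any other digits.\<close>

lemma mask_bits_strict_mono:
  assumes "x < y" "y < 2 ^ k" "finite J" "top_diff x y \<in> J"
  shows "mask_bits J x < mask_bits J y"
  using mask_bits_less[OF assms(3,4)] top_diff[OF assms(1,2)] by blast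

text \<open>A masked value is determined by which positions of \<open>J\<close> carry the digit 1,
  that is, by a subset of \<open>J\<close>.\<close>

lemma range_mask_bits:
  assumes "finite J"
  shows "finite (range (mask_bits J))" "card (range (mask_bits J)) \<le> 2 ^ card J"
proof -
  have sub: "range (mask_bits J) \<subseteq> (\<lambda>A. \<Sum>j\<in>A. 2 ^ j) ` Pow J"
  proof
    fix m assume "m \<in> range (mask_bits J)"
    then obtain x where "m = mask_bits J x" by auto
    also have "\<dots> = (\<Sum>j\<in>{j \<in> J. bit x j}. 2 ^ j)"
      unfolding mask_bits_def using assms by (intro sum.mono_neutral_cong_right) auto
    finally show "m \<in> (\<lambda>A. \<Sum>j\<in>A. 2 ^ j) ` Pow J" by blast
  qed
  show "finite (range (mask_bits J))" using finite_subset[OF sub] assms by simp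
  have "card (range (mask_bits J)) \<le> card ((\<lambda>A. \<Sum>j\<in>A. 2 ^ j :: nat) ` Pow J)"
    using sub assms by (intro card_mono) auto
  also have "\<dots> \<le> card (Pow J)" using assms by (intro card_image_le) auto
  finally show "card (range (mask_bits J)) \<le> 2 ^ card J" using assms by (simp add: card_Pow)
qed

section \<open>Depth reduction\<close>

text \<open>Downward induction from \<open>I = K\<close>: discarding an element with the largest
  value never raises the average. The inequality between averages is multiplied out to stay within
  the natural numbers.\<close>

lemma ex_subset_sum_le_average:
  fixes f :: "'b \<Rightarrow> nat"
  assumes "finite K" "s \<le> card K"
  shows "\<exists>I\<subseteq>K. card I = s \<and> card K * sum f I \<le> s * sum f K"
  using assms(2)
proof (induction s rule: inc_induct)
  case base
  then show ?case by auto
next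
  case (step s)
  then obtain I where I: "I \<subseteq> K" "card I = Suc s" "card K * sum f I \<le> Suc s * sum f K"
    by auto
  have fin: "finite I" using I assms(1) finite_subset by blast
  have "I \<noteq> {}" using I by auto
  then obtain a where a: "a \<in> I" "\<And>b. b \<in> I \<Longrightarrow> f b \<le> f a"
    using obtains_MAX[OF fin \<open>I \<noteq> {}\<close>, of f] Max_ge[of "f ` I"] fin
    by (metis finite_imageI imageI)
  have split: "sum f I = f a + sum f (I - {a})" using fin a by (simp add: sum.remove)
  have "sum f (I - {a}) \<le> s * f a"
    using sum_bounded_above[of "I - {a}" f "f a"] a I fin by auto
  then have "Suc s * sum f (I - {a}) \<le> s * sum f I"
    by (simp add: split algebra_simps)
  then have "card K * (Suc s * sum f (I - {a})) \<le> card K * (s * sum f I)"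
    by (rule mult_le_mono2)
  also have "\<dots> \<le> s * (Suc s * sum f K)"
    using mult_le_mono2[OF I(3), of s] by (simp only: ac_simps)
  finally have "Suc s * (card K * sum f (I - {a})) \<le> Suc s * (s * sum f K)"
    by (simp only: ac_simps)
  then have "card K * sum f (I - {a}) \<le> s * sum f K"
    by (simp only: mult_le_cancel1)
  moreover have "I - {a} \<subseteq> K" "card (I - {a}) = s" using I a fin by auto
  ultimately show ?case by blast
qed

text \<open>Each vertex is labelled with its number of proper ancestors. Along an arc the ancestor
  set grows by transitivity, and strictly so by acyclicity. Labels may repeat on vertices not joined
  by an arc.\<close>

lemma (in dag) ex_topological_numbering:
  "\<exists>l. (\<forall>v\<in>pverts G. l v < card (pverts G)) \<and> (\<forall>(u, v)\<in>parcs G. l u < (l v :: nat))"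
proof (intro exI conjI ballI)
  let ?P = "\<lambda>v. {u. (u, v) \<in> (parcs G)\<^sup>+}"
  have sub: "?P v \<subseteq> pverts G" for v
    by (auto dest!: tranclD in_arcsD1)
  have irrefl: "v \<notin> ?P v" for v
    using acyclic_parcs by (auto simp: acyclic_def)
  show "card (?P v) < card (pverts G)" if "v \<in> pverts G" for v
    using that sub irrefl pair_finite_verts by (intro psubset_card_mono) auto
  show "case e of (u, v) \<Rightarrow> card (?P u) < card (?P v)" if "e \<in> parcs G" for e
  proof (cases e)
    case (Pair u v)
    with that have "?P u \<subseteq> ?P v" "u \<in> ?P v" by auto
    then have "?P u \<subset> ?P v" using irrefl by blast
    moreover have "finite (?P v)" using sub pair_finite_verts finite_subset by blast
    ultimately show ?thesis using Pair by (auto intro: psubset_card_mono)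
  qed
qed

lemma increasing_along_vwalk:
  assumes "\<And>u v. (u, v) \<in> set (vwalk_arcs p) \<Longrightarrow> g u < (g v :: nat)"
  shows "sorted_wrt (<) (map g p)"
  using assms
proof (induction p rule: vwalk_arcs.induct)
  case (3 x y xs)
  then have "sorted_wrt (<) (map g (y # xs))" "g x < g y" by auto
  then show ?case by fastforce
qed auto

lemma vwalk_arcs_snd_in_set: "(u, v) \<in> set (vwalk_arcs p) \<Longrightarrow> v \<in> set p"
  by (induction p rule: vwalk_arcs.induct) auto

lemma (in dag) card_parcs_le:
  assumes "\<forall>v\<in>pverts G. in_degree (with_proj G) v \<le> d"
  shows "card (parcs G) \<le> d * card (pverts G)"
proof -
  have "parcs G = (\<Union>v\<in>pverts G. in_arcs G v)"
    by (auto simp: in_arcs_def dest: in_arcsD2)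
  then have "card (parcs G) \<le> (\<Sum>v\<in>pverts G. card (in_arcs G v))"
    using pair_finite_verts card_UN_le by metis
  also have "\<dots> \<le> (\<Sum>v\<in>pverts G. d)"
    using assms by (intro sum_mono) (auto simp: in_degree_def)
  finally show ?thesis by (simp add: mult.commute)
qed

lemma (in dag) depth_reduction:
  assumes deg: "\<forall>v\<in>pverts G. in_degree (with_proj G) v \<le> d"
    and k: "card (pverts G) \<le> 2 ^ k" and s: "s \<le> k"
  shows "\<exists>S\<subseteq>pverts G. k * card S \<le> s * (d * card (pverts G)) \<and>
    (S \<noteq> pverts G \<longrightarrow> codepth S G < 2 ^ (k - s))"
proof -
  obtain l where l: "\<And>v. v \<in> pverts G \<Longrightarrow> l v < card (pverts G)"
      "\<And>u v. (u, v) \<in> parcs G \<Longrightarrow> l u < (l v :: nat)"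
    using ex_topological_numbering by blast
  have lk: "l v < 2 ^ k" if "v \<in> pverts G" for v using l(1)[OF that] k by simp
  define cls where "cls = (\<lambda>(u, v). top_diff (l u) (l v))"
  define E where "E i = {e \<in> parcs G. cls e = i}" for i
  have cls: "cls e < k" if "e \<in> parcs G" for e
    using that l(2) lk in_arcsD2 top_diff(1) by (cases e) (auto simp: cls_def)
  have finE: "finite (E i)" for i
    unfolding E_def using pair_finite_arcs by simp
  have "parcs G = (\<Union>i<k. E i)" unfolding E_def using cls by auto
  then have "(\<Sum>i<k. card (E i)) = card (parcs G)"
    using finE by (subst card_UN_disjoint[symmetric]) (auto simp: E_def)
  moreover obtain I where I: "I \<subseteq> {..<k}" "card I = s"
    "k * (\<Sum>i\<in>I. card (E i)) \<le> s * (\<Sum>i<k. card (E i))"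
    using ex_subset_sum_le_average[of "{..<k}" s "\<lambda>i. card (E i)"] s by auto
  ultimately have le: "k * (\<Sum>i\<in>I. card (E i)) \<le> s * (d * card (pverts G))"
    using card_parcs_le[OF deg] by (metis le_trans mult_le_mono2)
  have finI: "finite I" using I(1) finite_subset by blast
  \<comment> \<open>Every arc of a class in \<open>I\<close> has its head in \<open>S\<close>, so a
    path avoiding \<open>S\<close> uses none of these arcs.\<close>
  define S where "S = snd ` (\<Union>i\<in>I. E i)"
  have "card S \<le> card (\<Union>i\<in>I. E i)"
    unfolding S_def using finI finE by (intro card_image_le) auto
  also have "\<dots> \<le> (\<Sum>i\<in>I. card (E i))" using finI by (rule card_UN_le)
  finally have "k * card S \<le> s * (d * card (pverts G))"
    using le by (meson le_trans mult_le_mono2)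
  moreover have sub: "S \<subseteq> pverts G"
    unfolding S_def E_def by (auto dest: in_arcsD2)
  moreover have "codepth S G < 2 ^ (k - s)" if "S \<noteq> pverts G"
  proof -
    let ?J = "{..<k} - I"
    have cJ: "card ?J = k - s" using I finI by (simp add: card_Diff_subset)
    have "codepth S G \<in> {vwalk_length p | p. vpath p (with_proj G) \<and> set p \<inter> S = {}}"
      unfolding codepth_def
      using that sub by (intro Max_in finite_codepth_set codepth_set_nonempty) auto
    then obtain p where p: "vpath p (with_proj G)" "set p \<inter> S = {}"
      "codepth S G = vwalk_length p" by auto
    then have p': "set p \<subseteq> pverts G" "set (vwalk_arcs p) \<subseteq> parcs G" "p \<noteq> []"
      by (auto simp: vpath_def vwalk_def)
    let ?g = "\<lambda>v. mask_bits ?J (l v)"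
    have "?g u < ?g v" if uv: "(u, v) \<in> set (vwalk_arcs p)" for u v
    proof -
      have e: "(u, v) \<in> parcs G" using uv p' by auto
      have "v \<notin> S" using vwalk_arcs_snd_in_set[OF uv] p by auto
      then have "(u, v) \<notin> E i" if "i \<in> I" for i
        using that unfolding S_def by force
      then have "cls (u, v) \<notin> I" using e unfolding E_def by auto
      then have "top_diff (l u) (l v) \<in> ?J" using cls[OF e] by (auto simp: cls_def)
      then show ?thesis
        using l(2)[OF e] lk[OF in_arcsD2[OF e]] by (intro mask_bits_strict_mono) auto
    qed
    then have "sorted_wrt (<) (map ?g p)" by (rule increasing_along_vwalk)
    then have "distinct (map ?g p)" by (simp add: strict_sorted_iff)
    then have "length p = card (?g ` set p)"
      by (metis distinct_card length_map set_map)
    also have "\<dots> \<le> card (range (mask_bits ?J))"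
      by (intro card_mono range_mask_bits) auto
    also have "\<dots> \<le> 2 ^ (k - s)" using range_mask_bits(2)[of ?J] cJ by simp
    finally have "length p \<le> 2 ^ (k - s)" .
    \<comment> \<open>\<open>vwalk_length\<close> counts arcs, one fewer than vertices, which makes
      the bound strict.\<close>
    then show ?thesis using p(3) p'(3) by (cases p) auto
  qed
  ultimately show ?thesis by blast
qed

section \<open>Growth of the depth in terms of the number of vertices\<close>

lemma ex_pow2_between:
  assumes "n \<ge> 1"
  shows "\<exists>k. n < 2 ^ k \<and> 2 ^ k \<le> 2 * (n :: nat)"
proof -
  define k where "k = (LEAST k. n < 2 ^ k)"
  have k: "n < 2 ^ k" unfolding k_def by (rule LeastI[of _ n]) simp
  then obtain j where j: "k = Suc j" using assms by (cases k) auto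
  then have "\<not> n < 2 ^ j" using not_less_Least[of j "\<lambda>k. n < 2 ^ k"] k_def by auto
  then show ?thesis using k j by (intro exI[of _ k]) simp
qed

text \<open>The set from \<open>depth_reduction\<close> is small enough to be tested against the
  extender property. The constant 4 collects two factors of 2: one from rounding \<open>s\<close>
  down, one from \<open>2 ^ k\<close> being as large as \<open>2 * ?N\<close>.\<close>

lemma (in dag) extender_bound:
  assumes deg: "\<forall>v\<in>pverts G. in_degree (with_proj G) v \<le> d" and d: "d \<ge> 1"
    and ext: "extender \<epsilon> \<rho> G" and eps: "0 < \<epsilon>" "\<epsilon> < 1"
  shows "\<rho> \<le> 4 * real (card (pverts G)) powr (1 - \<epsilon> / d)"
proof -
  let ?N = "card (pverts G)" and ?c = "\<epsilon> / d"
  have N: "?N \<ge> 1"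
    using verts_nonempty pair_finite_verts by (simp add: Suc_leI card_gt_0_iff)
  have c: "0 < ?c" "?c < 1" using eps d by (auto simp: field_simps)
  obtain k where k: "?N < 2 ^ k" "2 ^ k \<le> 2 * ?N" using ex_pow2_between[OF N] by blast
  \<comment> \<open>The strict inequality \<open>?N < 2 ^ k\<close> gives this even for a single
    vertex; it allows \<open>k\<close> to be cancelled below.\<close>
  have k0: "k > 0" using k(1) N by (cases k) auto
  \<comment> \<open>The largest number of classes for which the average bound
    \<open>s * d * ?N / k\<close> on the deleted vertices stays within
    \<open>\<epsilon> * ?N\<close>.\<close>
  define s where "s = nat \<lfloor>?c * k\<rfloor>"
  have "0 \<le> ?c * k" using c(1) by (intro mult_nonneg_nonneg) auto
  then have s1: "real s \<le> ?c * k" and s2: "?c * k - 1 < real s"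
    unfolding s_def by linarith+
  have "?c * k \<le> k" using c(2) by (intro mult_left_le_one_le) (use c in auto)
  then have sk: "s \<le> k" using s1 by simp
  obtain S where S: "S \<subseteq> pverts G" "k * card S \<le> s * (d * ?N)"
    "S \<noteq> pverts G \<Longrightarrow> codepth S G < 2 ^ (k - s)"
    using depth_reduction[OF deg less_imp_le[OF k(1)] sk] by blast
  have "real k * card S \<le> s * (d * ?N)"
    using S(2) by (metis of_nat_le_iff of_nat_mult)
  also have "\<dots> \<le> ?c * k * (d * ?N)"
    using mult_right_mono[OF s1, of "d * ?N"] by simp
  also have "\<dots> = k * (\<epsilon> * ?N)" using d by (simp add: field_simps)
  finally have card: "card S \<le> \<epsilon> * ?N" using k0 by simp
  \<comment> \<open>Here \<open>\<epsilon> < 1\<close> ensures that the deleted set is a proper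
    subset, as the codepth bounds require.\<close>
  also have "\<dots> < ?N" using eps N by simp
  finally have "S \<noteq> pverts G" by auto
  with S card ext have "\<rho> \<le> codepth S G" "codepth S G < 2 ^ (k - s)"
    by (auto simp: extender_def)
  then have "\<rho> \<le> real (2 ^ (k - s))" by linarith
  also have "\<dots> = 2 powr (real k - real s)"
    using sk powr_realpow[of 2 "k - s"] by (simp add: of_nat_diff)
  also have "\<dots> \<le> 2 powr (1 + k * (1 - ?c))" using s2 by (simp add: algebra_simps)
  also have "\<dots> = 2 * (2 ^ k) powr (1 - ?c)"
    by (simp only: powr_add powr_powr[symmetric] powr_realpow) simp
  also have "\<dots> \<le> 2 * (2 * ?N) powr (1 - ?c)"
  proof -
    have "(2 :: real) ^ k \<le> 2 * ?N"
      using of_nat_mono[OF k(2), where ?'a = real] by simp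
    then show ?thesis using c by (intro mult_left_mono powr_mono2) auto
  qed
  also have "\<dots> = 2 * (2 powr (1 - ?c) * ?N powr (1 - ?c))" by (simp add: powr_mult)
  also have "\<dots> \<le> 2 * (2 powr 1 * ?N powr (1 - ?c))"
    using c by (intro mult_left_mono mult_right_mono powr_mono) auto
  finally show ?thesis by simp
qed

theorem theorem6:
  fixes \<delta> :: "nat \<Rightarrow> real" and G :: "nat \<Rightarrow> 'a pair_pre_digraph"
  assumes "\<And>n. \<delta> n \<in> {0..1}"
    and "\<delta> \<longlonglongrightarrow> 1"
    and "\<And>n. dag (G n)"
    and "bounded_in_degrees G"
  shows "\<not> extender_seq (\<lambda>n. real n powr \<delta> n) G"
proof
  assume "extender_seq (\<lambda>n. real n powr \<delta> n) G"
  then obtain \<epsilon> C where lim: "filterlim (\<lambda>n. card (pverts (G n))) at_top sequentially"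
    and eps: "\<epsilon> > 0" and C: "C > 0"
    and ext: "\<And>n. extender \<epsilon> (C * real (card (pverts (G n))) powr \<delta> (card (pverts (G n)))) (G n)"
    unfolding extender_seq_def by blast
  obtain d where deg: "\<forall>n. \<forall>v\<in>pverts (G n). in_degree (with_proj (G n)) v \<le> d"
    using assms(4) unfolding bounded_in_degrees_def by blast
  \<comment> \<open>Shrinking \<open>\<epsilon>\<close> only weakens the extender property, and
    brings it below 1.\<close>
  define \<epsilon>' where "\<epsilon>' = min \<epsilon> (1 / 2)"
  have eps': "0 < \<epsilon>'" "\<epsilon>' < 1" "\<epsilon>' \<le> \<epsilon>" using eps by (auto simp: \<epsilon>'_def)
  \<comment> \<open>The maximum with 1 avoids division by zero, which would give
    \<open>c = 0\<close>.\<close>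
  define c where "c = \<epsilon>' / real (max d 1)"
  have c: "c > 0" using eps' by (simp add: c_def)
  have bound: "C * real (card (pverts (G n))) powr \<delta> (card (pverts (G n)))
      \<le> 4 * real (card (pverts (G n))) powr (1 - c)" for n
  proof -
    interpret dag "G n" using assms(3) .
    have "extender \<epsilon>' (C * real (card (pverts (G n))) powr \<delta> (card (pverts (G n)))) (G n)"
      using ext[of n] eps'(3) unfolding extender_def
      by (meson mult_right_mono of_nat_0_le_iff order_trans)
    moreover have "\<forall>v\<in>pverts (G n). in_degree (with_proj (G n)) v \<le> max d 1"
      using deg by (auto simp: le_max_iff_disj)
    ultimately show ?thesis
      unfolding c_def using eps' by (intro extender_bound) auto
  qed
  \<comment> \<open>The gap \<open>c\<close> between the exponents is split in half: one half
    absorbs the distance of \<open>\<delta> N\<close> from 1, the other outgrows the constant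
    \<open>4 / C\<close>.\<close>
  have "eventually (\<lambda>N. \<delta> N > 1 - c / 2) sequentially"
    using assms(2) c by (intro order_tendstoD(1)) auto
  moreover have "eventually (\<lambda>N. real N > (4 / C) powr (2 / c)) sequentially"
    using filterlim_real_sequentially by (simp add: filterlim_at_top_dense)
  then have "eventually (\<lambda>N. real N powr (c / 2) > 4 / C) sequentially"
  proof eventually_elim
    case (elim N)
    have "4 / C = ((4 / C) powr (2 / c)) powr (c / 2)"
      using c C by (simp add: powr_powr)
    also have "\<dots> < real N powr (c / 2)"
      using elim c by (intro powr_less_mono2) auto
    finally show ?case .
  qed
  ultimately have "eventually (\<lambda>N. 4 * real N powr (1 - c) < C * real N powr \<delta> N) sequentially"
    using eventually_ge_at_top[of 1]
  proof eventually_elim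
    case (elim N)
    have "4 * real N powr (1 - c) < C * real N powr (c / 2) * real N powr (1 - c)"
      using elim C by (intro mult_strict_right_mono) (auto simp: field_simps)
    also have "\<dots> = C * real N powr (1 - c / 2)" by (simp add: powr_add[symmetric])
    also have "\<dots> \<le> C * real N powr \<delta> N"
      using elim C by (intro mult_left_mono powr_mono) auto
    finally show ?case .
  qed
  \<comment> \<open>The comparison holds for all large \<open>N\<close>, hence at some graph size,
    since the sizes tend to infinity.\<close>
  from eventually_compose_filterlim[OF this lim]
  obtain n where "4 * real (card (pverts (G n))) powr (1 - c)
      < C * real (card (pverts (G n))) powr \<delta> (card (pverts (G n)))"
    by (auto simp: eventually_sequentially)
  with bound[of n] show False by simp
qed

end
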